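(* Let $G$ be a connected graph on $n$ vertices with girth $g$ and minimum degree $\delta \geq 2$. Then $$c(G) \leq \frac{6\,n\log(n)}{(\delta-1)^{\lfloor \frac{g+1}{4}\rfloor}}.$$
   Context: All graphs are finite, simple, undirected and connected. The girth of a graph is the length of its shortest cycle. $\log$ denotes the natural logarithm. The game of cops and robbers on a connected graph $G=(V,E)$ with $k$ cops: the cop player first places $k$ cops on vertices of $G$ (several cops may share a vertex), then the robber player chooses a vertex for the robber. The players then alternate turns, beginning with the cop player. On a turn, a player may move each of their pieces to a vertex adjacent to its current position, or leave that piece where it is (each piece independently). All positions are visible to both players. The cops win if after finitely many moves some cop moves onto the vertex currently occupied by the robber (the robber is captured; a robber who moves onto a vertex occupied by a cop can be captured on the next cop turn). The robber wins if he has a strategy to evade capture indefinitely. The cop number $c(G)$ is the least $k$ such that $k$ cops have a winning strategy on $G$, no matter which vertex the robber begins on and how he plays. *)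

theory Defs
  imports
    Complex_Main
    "HOL-Library.Extended_Nat"
    "Graph_Theory.Graph_Theory"
begin

(* Undirected graphs are symmetric digraphs (locale graph of Graph_Theory), so every edge is a
   pair of opposite arcs: the degree of a vertex is its out-degree, and going along an edge and
   back counts as a cycle of length 2 there.  Genuine cycles are those of length at least 3. *)

(* The girth of an acyclic graph is \<infinity>. *)
definition girth :: "('a, 'b) pre_digraph \<Rightarrow> enat" where
  "girth G = (INF p \<in> {p. pre_digraph.cycle G p \<and> 3 \<le> length p}. enat (length p))"

definition min_degree :: "('a, 'b) pre_digraph \<Rightarrow> nat" where
  "min_degree G = Min (out_degree G ` verts G)"

definition step :: "('a, 'b) pre_digraph \<Rightarrow> 'a \<Rightarrow> 'a \<Rightarrow> bool" where
  "step G u v \<longleftrightarrow> v = u \<or> u \<rightarrow>\<^bsub>G\<^esub> v"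

(* An infinite sequence of robber positions: r 0 is the vertex chosen at the start, and r (Suc t)
   is the position after the robber's (t+1)-st turn. *)
definition robber_play :: "('a, 'b) pre_digraph \<Rightarrow> (nat \<Rightarrow> 'a) \<Rightarrow> bool" where
  "robber_play G r \<longleftrightarrow> r 0 \<in> verts G \<and> (\<forall>t. step G (r t) (r (Suc t)))"

(* A strategy \<sigma> maps the list of all robber positions so far to the list of positions of the
   cops: \<sigma> [] is the initial placement, made before the robber has chosen a vertex, and
   \<sigma> [r 0, \<dots>, r t] is the configuration after the (t+1)-st turn of the cops, which is made
   with the robber at r t.  The i-th list entry is the i-th cop, and several cops may share a
   vertex.  The earlier cop positions are determined by \<sigma> itself, so this is the complete
   history of the game. *)
definition cop_strategy ::
  "('a, 'b) pre_digraph \<Rightarrow> nat \<Rightarrow> ('a list \<Rightarrow> 'a list) \<Rightarrow> bool" where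
  "cop_strategy G k \<sigma> \<longleftrightarrow>
     length (\<sigma> []) = k \<and> set (\<sigma> []) \<subseteq> verts G \<and>
     (\<forall>r. robber_play G r \<longrightarrow>
        (\<forall>t. list_all2 (step G) (\<sigma> (map r [0..<t])) (\<sigma> (map r [0..<Suc t]))))"

(* Capture takes place on a turn of the cops: after it, some cop is on the robber's vertex.
   What a play does after the first capture is irrelevant. *)
definition winning_cop_strategy ::
  "('a, 'b) pre_digraph \<Rightarrow> nat \<Rightarrow> ('a list \<Rightarrow> 'a list) \<Rightarrow> bool" where
  "winning_cop_strategy G k \<sigma> \<longleftrightarrow>
     cop_strategy G k \<sigma> \<and>
     (\<forall>r. robber_play G r \<longrightarrow> (\<exists>t. r t \<in> set (\<sigma> (map r [0..<Suc t]))))"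

definition cop_number :: "('a, 'b) pre_digraph \<Rightarrow> nat" where
  "cop_number G = (LEAST k. \<exists>\<sigma>. winning_cop_strategy G k \<sigma>)"

end

theory Submission
  imports Defs
begin

text \<open>
  Put \<open>r = \<lfloor>(g + 1) / 4\<rfloor>\<close>, so that \<open>4 * r - 2 < g\<close>.  The cops win within \<open>r\<close> turns: before their
  \<open>r\<close>-th turn the robber, who started at \<open>v\<close>, has moved \<open>r - 1\<close> times, so he sits in the ball of
  radius \<open>r - 1\<close> around \<open>v\<close>.  It is therefore enough to have, for every \<open>v\<close>, pairwise distinct cops
  that reach the vertices of this ball in \<open>r\<close> moves, one for each vertex
  (\<open>guards_of_ball_win\<close>).

  In general this would be a matching problem, but large girth makes it trivial.  Up to distance
  \<open>2 * r - 1\<close> from \<open>v\<close> the graph branches like a tree: a vertex at distance at least \<open>m\<close> from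
  \<open>v\<close> with two neighbours at distance at most \<open>m\<close> lies on a cycle of length at most \<open>2 * m + 2\<close>
  (\<open>girth_le_of_two_near_neighbours\<close>).  Hence a vertex \<open>x\<close> at distance less than \<open>r\<close> from \<open>v\<close> has
  at least \<open>(\<delta> - 1) ^ r\<close> descendants \<open>r\<close> levels below it (\<open>card_descendants\<close>), and different \<open>x\<close>
  have disjoint sets of such descendants: on different levels trivially, and on the same level by
  \<open>descendants_disjoint\<close>.  So if the initial positions of the cops meet every one of
  these descendant sets, then choosing a cop from each of them assigns distinct cops to distinct
  vertices of the ball.

  There are at most \<open>n\<^sup>2\<close> descendant sets, one for each pair \<open>(v, x)\<close>, and each has at least
  \<open>s = (\<delta> - 1) ^ r\<close> elements, so the greedy algorithm meets all of them with at most
  \<open>n / s * ln (n\<^sup>2) + 1\<close> vertices (\<open>small_hitting_set\<close>).  As \<open>s \<le> n\<close> and \<open>n \<ge> 3\<close>, this is at most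
  \<open>3 * n / s * ln n\<close>, half of what is claimed.
\<close>

section \<open>Hitting sets\<close>

text \<open>
  By double counting, some element of \<open>V\<close> lies in at least the fraction \<open>s / card V\<close> of the sets
  that are still missed; adding it to \<open>C\<close> reduces the number of missed sets by at least
  that fraction.
\<close>

lemma greedy_partial_hitting_set:
  assumes V: "finite V" "V \<noteq> {}" and F: "finite F"
    and S: "\<And>S. S \<in> F \<Longrightarrow> S \<subseteq> V \<and> s \<le> card S"
    and s: "s \<le> card V"
  shows "\<exists>C\<subseteq>V. card C \<le> t \<and>
    real (card {S \<in> F. S \<inter> C = {}}) \<le> real (card F) * (1 - real s / real (card V)) ^ t"
proof (induction t)
  case 0
  show ?case by (intro exI[of _ "{}"]) simp
next
  case (Suc t)
  then obtain C where C: "C \<subseteq> V" "card C \<le> t" 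
    and le: "real (card {S \<in> F. S \<inter> C = {}}) \<le> real (card F) * (1 - real s / real (card V)) ^ t"
    by blast
  define U where "U = {S \<in> F. S \<inter> C = {}}"
  have finU: "finite U" using F by (simp add: U_def)
  have V0: "card V > 0" using V by (simp add: card_gt_0_iff)
  have "(\<Sum>x\<in>V. card {S \<in> U. x \<in> S}) = (\<Sum>S\<in>U. card S)"
  proof (rule sum_multicount_gen[OF V(1) finU], intro ballI)
    fix S assume "S \<in> U"
    hence "{i \<in> V. i \<in> S} = S" using assms(4) by (auto simp: U_def)
    thus "card {i \<in> V. i \<in> S} = card S" by simp
  qed
  also have "\<dots> \<ge> s * card U"
    using sum_bounded_below[of U s card] S by (simp add: U_def mult.commute)
  finally have sum_ge: "s * card U \<le> (\<Sum>x\<in>V. card {S \<in> U. x \<in> S})" .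
  have "\<exists>x\<in>V. s * card U \<le> card V * card {S \<in> U. x \<in> S}"
  proof (rule ccontr)
    assume "\<not> ?thesis"
    hence lt: "\<And>x. x \<in> V \<Longrightarrow> card V * card {S \<in> U. x \<in> S} < s * card U" by force
    have "(\<Sum>x\<in>V. card V * card {S \<in> U. x \<in> S}) < (\<Sum>x\<in>V. s * card U)"
      by (rule sum_strict_mono) (use V lt in auto)
    hence "card V * (\<Sum>x\<in>V. card {S \<in> U. x \<in> S}) < card V * (s * card U)"
      by (simp add: sum_distrib_left)
    thus False using sum_ge V0 by simp
  qed
  then obtain x where x: "x \<in> V" "s * card U \<le> card V * card {S \<in> U. x \<in> S}" by blast
  have "{S \<in> F. S \<inter> insert x C = {}} = U - {S \<in> U. x \<in> S}" by (auto simp: U_def)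
  hence "real (card {S \<in> F. S \<inter> insert x C = {}}) = real (card U) - real (card {S \<in> U. x \<in> S})"
    using finU by (simp add: card_Diff_subset of_nat_diff card_mono)
  also have "\<dots> \<le> real (card U) * (1 - real s / real (card V))"
  proof -
    have "real s * real (card U) \<le> real (card V) * real (card {S \<in> U. x \<in> S})"
      using x(2) by (metis of_nat_le_iff of_nat_mult)
    thus ?thesis using V0 by (simp add: field_simps)
  qed
  also have "\<dots> \<le> (real (card F) * (1 - real s / real (card V)) ^ t) * (1 - real s / real (card V))"
    by (rule mult_right_mono) (use le s V0 in \<open>auto simp: U_def\<close>)
  finally have "real (card {S \<in> F. S \<inter> insert x C = {}})
      \<le> real (card F) * (1 - real s / real (card V)) ^ Suc t" by (simp add: mult_ac)
  moreover have "card (insert x C) \<le> Suc t"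
    using C card_insert_le_m1[of "Suc t" C x] by simp
  ultimately show ?case using x(1) C(1) by (intro exI[of _ "insert x C"]) auto
qed

text \<open>
  After \<open>t > card V / s * ln (card F)\<close> greedy steps the number of missed sets is at most
  \<open>card F * exp (- t * s / card V) < 1\<close>, hence zero.
\<close>

lemma small_hitting_set:
  assumes V: "finite V" and F: "finite F" "F \<noteq> {}"
    and S: "\<And>S. S \<in> F \<Longrightarrow> S \<subseteq> V \<and> s \<le> card S"
    and s: "s > 0"
  obtains C where "C \<subseteq> V" "\<And>S. S \<in> F \<Longrightarrow> S \<inter> C \<noteq> {}"
    "real (card C) \<le> real (card V) / real s * ln (real (card F)) + 1"
proof -
  obtain S0 where S0: "S0 \<in> F" using F by blast
  have sV: "s \<le> card V" using S[OF S0] card_mono[OF V, of S0] by simp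
  hence V0: "card V > 0" using s by simp
  hence Vne: "V \<noteq> {}" by auto
  define L where "L = real (card V) / real s * ln (real (card F))"
  have F1: "card F \<ge> 1" using F by (simp add: Suc_le_eq card_gt_0_iff)
  have L0: "L \<ge> 0" using F1 by (simp add: L_def)
  \<comment> \<open>The floor plus one, not the ceiling: \<open>t\<close> must exceed \<open>L\<close> strictly to get below \<open>1\<close>.\<close>
  define t where "t = Suc (nat \<lfloor>L\<rfloor>)"
  have t: "real t > L" "real t \<le> L + 1" using L0 by (auto simp: t_def) linarith+
  obtain C where C: "C \<subseteq> V" "card C \<le> t" and
    le: "real (card {S \<in> F. S \<inter> C = {}}) \<le> real (card F) * (1 - real s / real (card V)) ^ t"
    using greedy_partial_hitting_set[OF V Vne F(1) S sV, of t] by blast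
  have "(1 - real s / real (card V)) ^ t \<le> exp (- (real s / real (card V))) ^ t"
    using sV V0 exp_ge_add_one_self[of "- (real s / real (card V))"] by (intro power_mono) auto
  also have "\<dots> = exp (- (real t * (real s / real (card V))))"
    by (simp add: exp_of_nat_mult[symmetric])
  also have "\<dots> < exp (- ln (real (card F)))"
  proof -
    have "ln (real (card F)) = L * (real s / real (card V))"
      using s V0 by (simp add: L_def)
    also have "\<dots> < real t * (real s / real (card V))"
      using t(1) s V0 by (intro mult_strict_right_mono) auto
    finally show ?thesis by simp
  qed
  also have "\<dots> = 1 / real (card F)" using F1 by (simp add: exp_minus field_simps)
  finally have "real (card F) * (1 - real s / real (card V)) ^ t < 1"
    using F1 by (simp add: field_simps)
  hence "card {S \<in> F. S \<inter> C = {}} = 0" using le by linarith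
  hence "{S \<in> F. S \<inter> C = {}} = {}" using F(1) by simp
  moreover have "real (card C) \<le> L + 1" using C(2) t(2) by linarith
  ultimately show ?thesis using C(1) that unfolding L_def by blast
qed

section \<open>Short cycles\<close>

lemma (in wf_digraph) awalk_avoiding_imp_apath_avoiding:
  assumes "awalk x p y" "w \<notin> set (awalk_verts x p)"
  shows "\<exists>q. apath x q y \<and> length q \<le> length p \<and> w \<notin> set (awalk_verts x q)"
  using assms
proof (induction "length p" arbitrary: p rule: less_induct)
  case less
  show ?case
  proof (cases "distinct (awalk_verts x p)")
    case True
    thus ?thesis using less by (auto simp: apath_def)
  next
    case False
    obtain q r s z where d: "p = q @ r @ s" "distinct (awalk_verts x q)" "0 < length r"
      "awalk x q z" "awalk z r z" "awalk z s y"
      using awalk_not_distinct_decomp[OF less.prems(1) False] by blast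
    have qs: "awalk x (q @ s) y" using d by auto
    have sub: "set (awalk_verts x (q @ s)) \<subseteq> set (awalk_verts x p)"
      using d set_awalk_verts[OF qs] set_awalk_verts[OF less.prems(1)] by auto
    have "w \<notin> set (awalk_verts x (q @ s))" using sub less.prems(2) by blast
    moreover have "length (q @ s) < length p" using d by simp
    ultimately obtain q' where "apath x q' y" "length q' \<le> length (q @ s)"
       "w \<notin> set (awalk_verts x q')" using less.hyps[of "q @ s"] qs by blast
    thus ?thesis using d by (intro exI[of _ q']) auto
  qed
qed

lemma (in wf_digraph) relpow_avoiding_imp_awalk:
  assumes "(x, y) \<in> {(a, b) \<in> arcs_ends G. a \<noteq> w \<and> b \<noteq> w} ^^ n" "x \<noteq> w" "x \<in> verts G"
  shows "\<exists>p. awalk x p y \<and> length p = n \<and> w \<notin> set (awalk_verts x p)"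
  using assms
proof (induction n arbitrary: x)
  case 0
  thus ?case by (intro exI[of _ "[]"]) (auto simp: awalk_Nil_iff)
next
  case (Suc n)
  obtain z where z: "(x, z) \<in> {(a, b) \<in> arcs_ends G. a \<noteq> w \<and> b \<noteq> w}"
    "(z, y) \<in> {(a, b) \<in> arcs_ends G. a \<noteq> w \<and> b \<noteq> w} ^^ n"
    using relpow_Suc_D2[OF Suc.prems(1)] by blast
  then obtain e where e: "e \<in> arcs G" "tail G e = x" "head G e = z" "z \<noteq> w" by auto
  obtain p where "awalk z p y" "length p = n" "w \<notin> set (awalk_verts z p)"
    using Suc.IH[OF z(2)] e by auto
  thus ?case using e Suc.prems by (intro exI[of _ "e # p"]) (auto simp: awalk_Cons_iff)
qed

text \<open>
  A walk of length \<open>l\<close> from \<open>v\<close> can visit a vertex that is at distance at least \<open>l\<close> only as its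
  last vertex.
\<close>

lemma relpow_avoids_unreached:
  assumes "(v, x) \<in> A ^^ l" "x \<noteq> w" "\<And>j. j < l \<Longrightarrow> (v, w) \<notin> A ^^ j"
  shows "(v, x) \<in> {(a, b) \<in> A. a \<noteq> w \<and> b \<noteq> w} ^^ l"
  using assms
proof (induction l arbitrary: x)
  case (Suc l)
  obtain y where y: "(v, y) \<in> A ^^ l" "(y, x) \<in> A" using Suc.prems(1) by auto
  hence "y \<noteq> w" using Suc.prems(3) by blast
  thus ?case using Suc.IH[OF y(1)] y Suc.prems by (auto intro!: relpow_Suc_I)
qed simp

lemma sym_relpow:
  assumes "sym R"
  shows "sym (R ^^ n)"
proof (induction n)
  case (Suc n)
  show ?case
  proof (rule symI)
    fix x z assume "(x, z) \<in> R ^^ Suc n"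
    then obtain y where "(x, y) \<in> R ^^ n" "(y, z) \<in> R" by auto
    thus "(z, x) \<in> R ^^ Suc n" using assms Suc by (meson relpow_Suc_I2 symD)
  qed
qed (simp add: sym_def)

text \<open>
  The walks from \<open>v\<close> to \<open>x\<close> and to \<open>y\<close> are too short to pass through \<open>w\<close>, so together they contain
  a path from \<open>x\<close> to \<open>y\<close> that avoids \<open>w\<close>, of length at most \<open>2 * m\<close>.  The edges between \<open>w\<close> and
  \<open>x\<close>, \<open>y\<close> close it to a cycle, which has length at least \<open>3\<close> because \<open>x \<noteq> y\<close>.
\<close>

lemma (in graph) girth_le_of_two_near_neighbours:
  assumes x: "w \<rightarrow>\<^bsub>G\<^esub> x" "(v, x) \<in> arcs_ends G ^^ k" "k \<le> m"
    and y: "w \<rightarrow>\<^bsub>G\<^esub> y" "(v, y) \<in> arcs_ends G ^^ l" "l \<le> m"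
    and "x \<noteq> y" and w: "\<And>j. j < m \<Longrightarrow> (v, w) \<notin> arcs_ends G ^^ j"
  shows "girth G \<le> enat (2 * m + 2)"
proof -
  define F where "F = {(a, b) \<in> arcs_ends G. a \<noteq> w \<and> b \<noteq> w}"
  have symA: "sym (arcs_ends G)" using sym_arcs by (simp add: symmetric_def)
  hence symF: "sym F" by (auto simp: F_def sym_def)
  have xw: "x \<noteq> w" and yw: "y \<noteq> w" using x(1) y(1) adj_not_same by blast+
  \<comment> \<open>\<open>F\<close> consists of the edges of \<open>G\<close> with \<open>w\<close> deleted.\<close>
  have "(v, x) \<in> F ^^ k" "(v, y) \<in> F ^^ l" unfolding F_def
    using x(2,3) y(2,3) xw yw w by (auto intro!: relpow_avoids_unreached)
  hence "(x, y) \<in> F ^^ (k + l)"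
    using symD[OF sym_relpow[OF symF]] by (auto simp: relpow_add)
  then obtain p0 where "awalk x p0 y" "length p0 = k + l" "w \<notin> set (awalk_verts x p0)"
    using relpow_avoiding_imp_awalk xw adj_in_verts(2)[OF x(1)] unfolding F_def by blast
  then obtain p where p: "apath x p y" "length p \<le> k + l" "w \<notin> set (awalk_verts x p)"
    using awalk_avoiding_imp_apath_avoiding by metis
  have pw: "awalk x p y" using p(1) by (simp add: apath_def)
  have pne: "p \<noteq> []" using p(1) \<open>x \<noteq> y\<close> by (auto simp: apath_Nil_iff)
  obtain e where e: "e \<in> arcs G" "tail G e = w" "head G e = x" using x(1) by auto
  have "y \<rightarrow>\<^bsub>G\<^esub> w" using y(1) symA by (auto dest: symD)
  then obtain f where f: "f \<in> arcs G" "tail G f = y" "head G f = w" by auto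
  have pf: "awalk x (p @ [f]) w"
    using pw f adj_in_verts[OF y(1)] by (auto simp: awalk_Cons_iff awalk_Nil_iff)
  have "awalk w (e # p @ [f]) w"
    using pf e adj_in_verts[OF x(1)] by (auto simp: awalk_Cons_iff)
  moreover have "awalk_verts x (p @ [f]) = awalk_verts x p @ [w]"
    using pf f pw by (subst awalk_verts_append) auto
  hence "distinct (tl (awalk_verts w (e # p @ [f])))"
    using p e by (simp add: apath_def)
  ultimately have "cycle (e # p @ [f])" by (auto simp: cycle_def)
  moreover have "3 \<le> length (e # p @ [f])" using pne by (cases p) auto
  ultimately have "girth G \<le> enat (length (e # p @ [f]))"
    unfolding girth_def by (intro INF_lower) auto
  also have "\<dots> \<le> enat (2 * m + 2)" using p(2) x(3) y(3) by simp
  finally show ?thesis .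
qed

section \<open>Layers and descendants\<close>

text \<open>
  The vertices at distance exactly \<open>n\<close> from \<open>v\<close>.
\<close>

definition layer :: "('a, 'b) pre_digraph \<Rightarrow> 'a \<Rightarrow> nat \<Rightarrow> 'a set" where
  "layer G v n = {w. (v, w) \<in> arcs_ends G ^^ n \<and> (\<forall>m<n. (v, w) \<notin> arcs_ends G ^^ m)}"

text \<open>
  For \<open>x\<close> in layer \<open>n\<close>: the endpoints of the shortest paths from \<open>v\<close> that pass through \<open>x\<close> and go
  on for \<open>j\<close> more steps.  If the girth exceeds \<open>2 * (n + j)\<close>, these are the descendants of \<open>x\<close> in the breadth-first
  search tree rooted at \<open>v\<close>.
\<close>

definition descendants :: "('a, 'b) pre_digraph \<Rightarrow> 'a \<Rightarrow> nat \<Rightarrow> 'a \<Rightarrow> nat \<Rightarrow> 'a set" where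
  "descendants G v n x j = {w \<in> layer G v (n + j). (x, w) \<in> arcs_ends G ^^ j}"

lemma layer_unique: "x \<in> layer G v n \<Longrightarrow> x \<in> layer G v m \<Longrightarrow> n = m"
  unfolding layer_def by (metis (mono_tags, lifting) mem_Collect_eq linorder_neqE_nat)

lemma (in wf_digraph) relpow_in_verts:
  "(v, x) \<in> arcs_ends G ^^ n \<Longrightarrow> v \<in> verts G \<Longrightarrow> x \<in> verts G"
  by (cases n) (auto dest: adj_in_verts)

lemma (in wf_digraph) layer_subset_verts: "v \<in> verts G \<Longrightarrow> layer G v n \<subseteq> verts G"
  by (auto simp: layer_def dest: relpow_in_verts)

lemma ex_layer_of_relpow:
  assumes "(v, x) \<in> arcs_ends G ^^ k"
  obtains n where "n \<le> k" "x \<in> layer G v n"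
proof -
  define n where "n = (LEAST n. (v, x) \<in> arcs_ends G ^^ n)"
  have "(v, x) \<in> arcs_ends G ^^ n" "n \<le> k"
    using assms unfolding n_def by (auto intro: LeastI Least_le)
  moreover have "\<forall>m<n. (v, x) \<notin> arcs_ends G ^^ m"
    using not_less_Least unfolding n_def by blast
  ultimately show ?thesis using that by (auto simp: layer_def)
qed

lemma descendants_0: "x \<in> layer G v n \<Longrightarrow> descendants G v n x 0 = {x}"
  by (auto simp: descendants_def)

text \<open>
  The vertex before the last one on a shortest path through \<open>x\<close> is again the end of a shortest path
  through \<open>x\<close>; this recursion makes induction on the depth possible.
\<close>

lemma descendants_Suc:
  assumes "x \<in> layer G v n"
  shows "descendants G v n x (Suc j) =
    (\<Union>z\<in>descendants G v n x j. {w \<in> layer G v (Suc (n + j)). z \<rightarrow>\<^bsub>G\<^esub> w})"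
proof -
  have "z \<in> layer G v (n + j)"
    if z: "(x, z) \<in> arcs_ends G ^^ j" "z \<rightarrow>\<^bsub>G\<^esub> w" and w: "w \<in> layer G v (Suc (n + j))" for z w
  proof -
    have "(v, z) \<in> arcs_ends G ^^ (n + j)"
      using assms z by (auto simp: layer_def relpow_add)
    moreover have "(v, z) \<notin> arcs_ends G ^^ m" if "m < n + j" for m
    proof
      assume "(v, z) \<in> arcs_ends G ^^ m"
      hence "(v, w) \<in> arcs_ends G ^^ Suc m" using z by auto
      thus False using w that unfolding layer_def by blast
    qed
    ultimately show ?thesis by (auto simp: layer_def)
  qed
  thus ?thesis by (auto simp: descendants_def)
qed

context graph
begin

lemma near_neighbour_unique:
  assumes "w \<rightarrow>\<^bsub>G\<^esub> x" "(v, x) \<in> arcs_ends G ^^ k" "k \<le> m"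
    and "w \<rightarrow>\<^bsub>G\<^esub> y" "(v, y) \<in> arcs_ends G ^^ l" "l \<le> m"
    and "\<And>j. j < m \<Longrightarrow> (v, w) \<notin> arcs_ends G ^^ j"
    and "enat (2 * m + 2) < girth G"
  shows "x = y"
  using girth_le_of_two_near_neighbours[OF assms(1-6) _ assms(7)] assms(8) by fastforce

text \<open>
  Tree-likeness upwards: each vertex of layer \<open>n + 1\<close> has only one parent.
\<close>

lemma common_child_imp_eq:
  assumes "x \<in> layer G v n" "y \<in> layer G v n" "w \<in> layer G v (Suc n)"
    and "x \<rightarrow>\<^bsub>G\<^esub> w" "y \<rightarrow>\<^bsub>G\<^esub> w" and "enat (2 * n + 2) < girth G"
  shows "x = y"
proof (rule near_neighbour_unique[of w x v n n y n])
  show "w \<rightarrow>\<^bsub>G\<^esub> x" "w \<rightarrow>\<^bsub>G\<^esub> y" using assms(4,5) sym_arcs by (auto dest: arcs_ends_symmetric)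
qed (use assms in \<open>auto simp: layer_def\<close>)

lemma card_neighbours: "card {w. x \<rightarrow>\<^bsub>G\<^esub> w} = out_degree G x"
proof -
  have "{w. x \<rightarrow>\<^bsub>G\<^esub> w} = head G ` out_arcs G x" by (auto simp: arcs_ends_conv)
  moreover have "inj_on (head G) (out_arcs G x)"
    by (rule inj_onI) (auto intro!: no_multi_arcs simp: arc_to_ends_def)
  ultimately show ?thesis by (simp add: out_degree_def card_image)
qed

lemma min_degree_le: "x \<in> verts G \<Longrightarrow> min_degree G \<le> card {w. x \<rightarrow>\<^bsub>G\<^esub> w}"
  by (simp add: card_neighbours min_degree_def)

lemma finite_neighbours: "finite {w. x \<rightarrow>\<^bsub>G\<^esub> w}"
  by (rule finite_subset[OF _ finite_verts]) (auto dest: adj_in_verts)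

text \<open>
  Tree-likeness downwards: at most one neighbour of \<open>x\<close>, its parent, fails to be a child, because
  such neighbours all have distance at most \<open>n\<close> from \<open>v\<close>.
\<close>

lemma card_children:
  assumes v: "v \<in> verts G" and x: "x \<in> layer G v n" and g: "enat (2 * n + 2) < girth G"
  shows "min_degree G - 1 \<le> card {w \<in> layer G v (Suc n). x \<rightarrow>\<^bsub>G\<^esub> w}"
proof -
  let ?N = "{w. x \<rightarrow>\<^bsub>G\<^esub> w}" and ?C = "{w \<in> layer G v (Suc n). x \<rightarrow>\<^bsub>G\<^esub> w}"
  have far: "\<exists>k\<le>n. (v, w) \<in> arcs_ends G ^^ k" if "w \<in> ?N - ?C" for w
  proof -
    have "(v, w) \<in> arcs_ends G ^^ Suc n" using that x by (auto simp: layer_def)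
    thus ?thesis using that by (auto simp: layer_def less_Suc_eq_le)
  qed
  have "y = z" if yz: "y \<in> ?N - ?C" "z \<in> ?N - ?C" for y z
  proof -
    obtain k l where "k \<le> n" "(v, y) \<in> arcs_ends G ^^ k" "l \<le> n" "(v, z) \<in> arcs_ends G ^^ l"
      using far yz by meson
    thus ?thesis using near_neighbour_unique[of x y v k n z l] x yz g by (auto simp: layer_def)
  qed
  hence "card (?N - ?C) \<le> 1" 
    using finite_neighbours by (subst card_le_Suc0_iff_eq[unfolded One_nat_def[symmetric]]) auto
  moreover have "card ?N = card ?C + card (?N - ?C)"
  proof -
    have "?C \<subseteq> ?N" by blast
    thus ?thesis using card_Diff_subset[of ?C ?N] card_mono[of ?N ?C] finite_neighbours[of x]
      by (simp add: finite_subset)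
  qed
  moreover have "min_degree G \<le> card ?N"
    using min_degree_le layer_subset_verts[OF v] x by blast
  ultimately show ?thesis by linarith
qed

text \<open>
  Climbing from a common descendant through unique parents leads back to a single vertex of
  layer \<open>n\<close>.
\<close>

lemma descendants_disjoint:
  assumes "x \<in> layer G v n" "y \<in> layer G v n" "x \<noteq> y" "enat (2 * (n + j)) < girth G"
  shows "descendants G v n x j \<inter> descendants G v n y j = {}"
  using assms(4)
proof (induction j)
  case 0
  thus ?case using assms by (simp add: descendants_0)
next
  case (Suc j)
  have g: "enat (2 * (n + j) + 2) < girth G" using Suc.prems by simp
  have "enat (2 * (n + j)) < enat (2 * (n + j) + 2)" by simp
  hence IH: "descendants G v n x j \<inter> descendants G v n y j = {}"
    using Suc.IH g less_trans by blast
  show ?case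
  proof (rule ccontr)
    assume "\<not> ?thesis"
    then obtain w z z' where w: "w \<in> layer G v (Suc (n + j))"
      and z: "z \<in> descendants G v n x j" "z \<rightarrow>\<^bsub>G\<^esub> w"
      and z': "z' \<in> descendants G v n y j" "z' \<rightarrow>\<^bsub>G\<^esub> w"
      using assms by (auto simp: descendants_Suc)
    hence "z = z'" using common_child_imp_eq[of z v "n + j" z' w] g
      by (simp add: descendants_def)
    thus False using IH z z' by blast
  qed
qed

lemma finite_layer: "v \<in> verts G \<Longrightarrow> finite (layer G v n)"
  using layer_subset_verts finite_subset finite_verts by blast

text \<open>
  Each level of descendants is at least \<open>min_degree G - 1\<close> times as large as the one before: every
  vertex has that many children, and no child is counted twice.
\<close>

lemma card_descendants:
  assumes "v \<in> verts G" "x \<in> layer G v n" "enat (2 * (n + j)) < girth G"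
  shows "(min_degree G - 1) ^ j \<le> card (descendants G v n x j)"
  using assms(3)
proof (induction j)
  case 0
  thus ?case using assms by (simp add: descendants_0)
next
  case (Suc j)
  let ?D = "descendants G v n x j" and ?C = "\<lambda>z. {w \<in> layer G v (Suc (n + j)). z \<rightarrow>\<^bsub>G\<^esub> w}"
  have g: "enat (2 * (n + j) + 2) < girth G" using Suc.prems by simp
  have "enat (2 * (n + j)) < enat (2 * (n + j) + 2)" by simp
  hence IH: "(min_degree G - 1) ^ j \<le> card ?D"
    using Suc.IH g less_trans by blast
  have D: "?D \<subseteq> layer G v (n + j)" by (auto simp: descendants_def)
  have fin: "finite ?D" using finite_subset[OF D] finite_layer assms(1) by blast
  have "(min_degree G - 1) ^ Suc j \<le> card ?D * (min_degree G - 1)"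
    using mult_right_mono[OF IH, of "min_degree G - 1"] by (simp add: mult.commute)
  also have "\<dots> \<le> (\<Sum>z\<in>?D. card (?C z))"
    using sum_bounded_below[of ?D "min_degree G - 1" "\<lambda>z. card (?C z)"] 
      card_children[OF assms(1) _ g] D by (auto simp: subset_iff)
  also have "\<dots> = card (\<Union>z\<in>?D. ?C z)"
  proof (rule card_UN_disjoint[symmetric])
    show "\<forall>z\<in>?D. finite (?C z)" using finite_layer assms(1) by simp
    show "\<forall>y\<in>?D. \<forall>z\<in>?D. y \<noteq> z \<longrightarrow> ?C y \<inter> ?C z = {}"
      using common_child_imp_eq[OF _ _ _ _ _ g] D by blast
  qed (rule fin)
  also have "\<dots> = card (descendants G v n x (Suc j))"
    using assms by (simp add: descendants_Suc)
  finally show ?case .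
qed

end

section \<open>Surrounding the robber\<close>

text \<open>
  Once the robber has chosen \<open>v\<close>, the cop at \<open>f v u\<close> walks to \<open>u\<close>, for every \<open>u\<close> in the ball of
  radius \<open>r - 1\<close> around \<open>v\<close>; injectivity of \<open>f v\<close> ensures that no cop gets two destinations.  After
  \<open>r\<close> turns the whole ball is occupied, while the robber, who has moved only \<open>r - 1\<close> times, is
  still inside it.
\<close>

lemma (in graph) guards_of_ball_win:
  assumes C: "C \<subseteq> verts G" and r: "r > 0"
    and inj: "\<And>v. v \<in> verts G \<Longrightarrow> inj_on (f v) (\<Union>k<r. (arcs_ends G ^^ k) `` {v})"
    and guard: "\<And>v u k. v \<in> verts G \<Longrightarrow> k < r \<Longrightarrow> (v, u) \<in> arcs_ends G ^^ k \<Longrightarrow>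
       f v u \<in> C \<and> (f v u, u) \<in> arcs_ends G ^^ r"
  shows "\<exists>\<sigma>. winning_cop_strategy G (card C) \<sigma>"
proof -
  define B where "B v = (\<Union>k<r. (arcs_ends G ^^ k) `` {v})" for v
  \<comment> \<open>\<open>P v c t\<close> will be the position after turn \<open>t\<close> of the cop that starts at \<open>c\<close>, when the robber
    starts at \<open>v\<close>.  After \<open>r\<close> steps it stays where it is.\<close>
  have "\<exists>P. P 0 = c \<and> (\<forall>t. step G (P t) (P (Suc t))) \<and> (\<forall>u\<in>B v. f v u = c \<longrightarrow> P r = u)"
    if v: "v \<in> verts G" for v c
  proof (cases "c \<in> f v ` B v")
    case True
    then obtain u where u: "u \<in> B v" "c = f v u" by blast
    hence "(c, u) \<in> arcs_ends G ^^ r" using guard v by (auto simp: B_def)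
    then obtain h where h: "h 0 = c" "h r = u" "\<forall>i<r. (h i, h (Suc i)) \<in> arcs_ends G"
      by (auto simp: relpow_fun_conv)
    have "\<forall>t. step G (h (min t r)) (h (min (Suc t) r))"
    proof
      fix t
      show "step G (h (min t r)) (h (min (Suc t) r))"
        using h(3) by (cases "t < r") (auto simp: step_def min_def)
    qed
    moreover have "\<forall>u'\<in>B v. f v u' = c \<longrightarrow> u = u'"
      using inj[OF v] u by (auto simp: B_def[symmetric] inj_on_def)
    ultimately show ?thesis using h by (intro exI[of _ "\<lambda>t. h (min t r)"]) auto
  next
    case False
    thus ?thesis by (intro exI[of _ "\<lambda>_. c"]) (auto simp: step_def)
  qed
  then obtain P where P0: "\<And>v c. v \<in> verts G \<Longrightarrow> P v c 0 = c"
    and Pstep: "\<And>v c t. v \<in> verts G \<Longrightarrow> step G (P v c t) (P v c (Suc t))"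
    and Pend: "\<And>v u. v \<in> verts G \<Longrightarrow> u \<in> B v \<Longrightarrow> P v (f v u) r = u"
    by metis
  obtain cs where cs: "set cs = C" "distinct cs"
    using finite_distinct_list finite_subset[OF C finite_verts] by blast
  define \<sigma> where "\<sigma> xs = (if xs = [] then cs else map (\<lambda>c. P (hd xs) c (length xs)) cs)" for xs
  have \<sigma>: "\<sigma> (map \<rho> [0..<t]) = map (\<lambda>c. P (\<rho> 0) c t) cs" if "robber_play G \<rho>" for \<rho> t
    using that P0 by (cases t) (auto simp: \<sigma>_def robber_play_def hd_map map_idI simp del: upt_Suc)
  have "cop_strategy G (card C) \<sigma>"
    unfolding cop_strategy_def
  proof (intro conjI allI impI)
    show "length (\<sigma> []) = card C" "set (\<sigma> []) \<subseteq> verts G"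
      using cs C distinct_card[OF cs(2)] by (auto simp: \<sigma>_def)
    fix \<rho> t assume "robber_play G \<rho>"
    thus "list_all2 (step G) (\<sigma> (map \<rho> [0..<t])) (\<sigma> (map \<rho> [0..<Suc t]))"
      using Pstep by (simp only: \<sigma>) (auto simp: list_all2_conv_all_nth robber_play_def)
  qed
  moreover have "\<rho> (r - 1) \<in> set (\<sigma> (map \<rho> [0..<Suc (r - 1)]))" if \<rho>: "robber_play G \<rho>" for \<rho>
  proof -
    have reach: "\<exists>k\<le>t. (\<rho> 0, \<rho> t) \<in> arcs_ends G ^^ k" for t
    proof (induction t)
      case (Suc t)
      then obtain k where k: "k \<le> t" "(\<rho> 0, \<rho> t) \<in> arcs_ends G ^^ k" by blast
      have "step G (\<rho> t) (\<rho> (Suc t))" using \<rho> by (simp add: robber_play_def)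
      thus ?case
      proof (cases "\<rho> (Suc t) = \<rho> t")
        case False
        hence "(\<rho> 0, \<rho> (Suc t)) \<in> arcs_ends G ^^ Suc k"
          using k \<open>step G _ _\<close> by (auto simp: step_def)
        thus ?thesis using k(1) Suc_le_mono by blast
      qed (use k in \<open>auto intro: le_SucI\<close>)
    qed simp
    have v: "\<rho> 0 \<in> verts G" using \<rho> by (simp add: robber_play_def)
    obtain k where k: "k < r" "(\<rho> 0, \<rho> (r - 1)) \<in> arcs_ends G ^^ k"
      using reach[of "r - 1"] r by (metis Suc_pred' less_Suc_eq_le)
    hence B: "\<rho> (r - 1) \<in> B (\<rho> 0)" by (auto simp: B_def)
    have "f (\<rho> 0) (\<rho> (r - 1)) \<in> set cs" using guard[OF v k] cs by simp
    thus ?thesis using r Pend[OF v B] by (force simp: \<sigma>[OF \<rho>] simp del: upt_Suc)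
  qed
  ultimately show ?thesis unfolding winning_cop_strategy_def by blast
qed

text \<open>
  A cop that is an \<open>r\<close>-th descendant of \<open>x\<close> reaches \<open>x\<close> in \<open>r\<close> moves.  The sets it is chosen from
  lie in layers up to \<open>(r - 1) + r\<close>, which is as deep as the bound \<open>4 * r - 2 = 2 * (2 * r - 1)\<close> on
  the girth guarantees disjointness.
\<close>

lemma (in graph) descendant_hitting_set_wins:
  assumes C: "C \<subseteq> verts G" and r: "r > 0" and g: "enat (4 * r - 2) < girth G"
    and hit: "\<And>v n x. v \<in> verts G \<Longrightarrow> n < r \<Longrightarrow> x \<in> layer G v n \<Longrightarrow> descendants G v n x r \<inter> C \<noteq> {}"
  shows "\<exists>\<sigma>. winning_cop_strategy G (card C) \<sigma>"
proof -
  define dep where "dep v u = (LEAST n. (v, u) \<in> arcs_ends G ^^ n)" for v u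
  have dep: "u \<in> layer G v (dep v u) \<and> dep v u < r"
    if "k < r" "(v, u) \<in> arcs_ends G ^^ k" for v u k
  proof -
    have "dep v u \<le> k" "(v, u) \<in> arcs_ends G ^^ dep v u" 
      using that unfolding dep_def by (auto intro: LeastI Least_le)
    thus ?thesis using that not_less_Least unfolding layer_def dep_def by fastforce
  qed
  define f where "f v u = (SOME c. c \<in> descendants G v (dep v u) u r \<inter> C)" for v u
  have f: "f v u \<in> descendants G v (dep v u) u r \<inter> C"
    if "v \<in> verts G" "k < r" "(v, u) \<in> arcs_ends G ^^ k" for v u k
    unfolding f_def some_in_eq using hit dep that by blast
  show ?thesis
  proof (rule guards_of_ball_win[OF C r])
    fix v assume v: "v \<in> verts G"
    show "inj_on (f v) (\<Union>k<r. (arcs_ends G ^^ k) `` {v})"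
    proof (rule inj_onI)
      fix x y assume "x \<in> (\<Union>k<r. (arcs_ends G ^^ k) `` {v})" "y \<in> (\<Union>k<r. (arcs_ends G ^^ k) `` {v})"
        and eq: "f v x = f v y"
      then obtain k l where k: "k < r" "(v, x) \<in> arcs_ends G ^^ k"
        and l: "l < r" "(v, y) \<in> arcs_ends G ^^ l" by auto
      have x: "f v x \<in> descendants G v (dep v x) x r" and y: "f v x \<in> descendants G v (dep v y) y r"
        using f[OF v k] f[OF v l] eq by auto
      \<comment> \<open>The layer of the common cop determines the depth of its destination.\<close>
      hence d: "dep v x = dep v y" unfolding descendants_def using layer_unique by fastforce
      have "enat (2 * (dep v x + r)) \<le> enat (4 * r - 2)" using dep[OF k] by auto
      hence "enat (2 * (dep v x + r)) < girth G" using g by (rule le_less_trans)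
      thus "x = y" using descendants_disjoint[of x v "dep v x" y r] dep[OF k] dep[OF l] d x y by auto
    qed
  next
    fix v u k assume "v \<in> verts G" "k < r" "(v, u) \<in> arcs_ends G ^^ k"
    hence "f v u \<in> descendants G v (dep v u) u r \<inter> C" using f by blast
    moreover have "sym (arcs_ends G ^^ r)" using sym_arcs by (simp add: symmetric_def sym_relpow)
    ultimately show "f v u \<in> C \<and> (f v u, u) \<in> arcs_ends G ^^ r"
      by (auto simp: descendants_def dest: symD)
  qed
qed

section \<open>The bound\<close>

theorem theorem1p1:
  fixes G :: "('a, 'b) pre_digraph" and n g \<delta> :: nat
  assumes "graph G" and "Digraph_Component.connected G"
    and "card (verts G) = n"
    and "girth G = enat g"
    and "min_degree G = \<delta>" and "\<delta> \<ge> 2"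
  shows "real (cop_number G)
    \<le> 6 * real n * ln (real n) / (real \<delta> - 1) ^ nat \<lfloor>(real g + 1) / 4\<rfloor>"
proof -
  interpret graph G by fact
  define r where "r = nat \<lfloor>(real g + 1) / 4\<rfloor>"
  define s where "s = (\<delta> - 1) ^ r"
  have "enat 3 \<le> girth G" unfolding girth_def by (intro INF_greatest) auto
  hence g3: "g \<ge> 3" using assms(4) by simp
  have r0: "r > 0" using g3 unfolding r_def by simp
  have "real r \<le> (real g + 1) / 4" unfolding r_def by (rule of_nat_floor) simp
  hence "real (4 * r) \<le> real (g + 1)" by (simp add: field_simps)
  hence r4: "4 * r \<le> g + 1" by (simp only: of_nat_le_iff)
  hence gr: "enat (4 * r - 2) < girth G" using assms(4) r0 by simp
  have s0: "s > 0" using assms(6) by (simp add: s_def)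
  have "verts G \<noteq> {}"
    using assms(2) by (auto simp: connected_def strongly_connected_def)
  then obtain v0 where v0: "v0 \<in> verts G" by blast
  have v0': "v0 \<in> layer G v0 0" by (simp add: layer_def)
  define F where "F = {descendants G v k x r | v k x. v \<in> verts G \<and> k < r \<and> x \<in> layer G v k}"
  have Fne: "F \<noteq> {}" using v0 v0' r0 unfolding F_def by blast
  \<comment> \<open>Since \<open>v\<close> and \<open>x\<close> determine the depth \<open>k\<close>, there are at most \<open>n\<^sup>2\<close> sets, not \<open>n\<^sup>2 * r\<close>.\<close>
  have FV: "F \<subseteq> (\<lambda>(v, x). descendants G v (THE k. x \<in> layer G v k) x r) ` (verts G \<times> verts G)"
  proof
    fix S assume "S \<in> F"
    then obtain v k x where S: "S = descendants G v k x r" "v \<in> verts G" "x \<in> layer G v k"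
      by (auto simp: F_def)
    have "(THE k. x \<in> layer G v k) = k"
      by (rule the_equality) (fact S(3), rule layer_unique[OF _ S(3)])
    moreover have "x \<in> verts G" using layer_subset_verts[OF S(2)] S(3) by blast
    ultimately show "S \<in> (\<lambda>(v, x). descendants G v (THE k. x \<in> layer G v k) x r) ` (verts G \<times> verts G)"
      using S(1,2) by (intro image_eqI[of _ _ "(v, x)"]) simp_all
  qed
  have Ffin: "finite F" by (rule finite_subset[OF FV]) simp
  have "card F \<le> card (verts G \<times> verts G)" by (rule surj_card_le[OF _ FV]) simp
  hence Fcard: "card F \<le> n * n" using assms(3) by (simp add: card_cartesian_product)
  have Fsets: "S \<subseteq> verts G \<and> s \<le> card S" if SF: "S \<in> F" for S
  proof -
    obtain v k x where S: "S = descendants G v k x r" "v \<in> verts G" "k < r" "x \<in> layer G v k"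
      using SF unfolding F_def by blast
    have "enat (2 * (k + r)) \<le> enat (4 * r - 2)" using S(3) by simp
    hence "enat (2 * (k + r)) < girth G" using gr by (rule le_less_trans)
    hence "s \<le> card S" using card_descendants[OF S(2,4)] S(1) assms(5) by (simp add: s_def)
    moreover have "S \<subseteq> verts G"
      using S layer_subset_verts by (auto simp: descendants_def)
    ultimately show ?thesis by simp
  qed
  obtain C where C: "C \<subseteq> verts G" "\<And>S. S \<in> F \<Longrightarrow> S \<inter> C \<noteq> {}"
    and Cle: "real (card C) \<le> real (card (verts G)) / real s * ln (real (card F)) + 1"
    using small_hitting_set[OF finite_verts Ffin Fne Fsets s0] by blast
  have "\<exists>\<sigma>. winning_cop_strategy G (card C) \<sigma>"
    by (rule descendant_hitting_set_wins[OF C(1) r0 gr]) (use C(2) in \<open>auto simp: F_def\<close>)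
  hence "cop_number G \<le> card C" unfolding cop_number_def by (rule Least_le)
  hence cop: "real (cop_number G) \<le> real n / real s * ln (real (card F)) + 1"
    using Cle assms(3) by simp
  \<comment> \<open>A vertex and its at least two neighbours: \<open>n \<ge> 3 > exp 1\<close>, which together with
    \<open>s \<le> n\<close> makes the additive \<open>1\<close> above at most \<open>n / s * ln n\<close>.\<close>
  have "card (insert v0 {w. v0 \<rightarrow>\<^bsub>G\<^esub> w}) \<le> n"
    unfolding assms(3)[symmetric] by (rule card_mono) (auto simp: v0 dest: adj_in_verts)
  moreover have "v0 \<notin> {w. v0 \<rightarrow>\<^bsub>G\<^esub> w}" using adj_not_same by blast
  ultimately have n3: "n \<ge> 3"
    using min_degree_le[OF v0] assms(5,6) finite_neighbours by simp
  have "exp 1 \<le> real n" using exp_le n3 by linarith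
  hence ln1: "1 \<le> ln (real n)" using n3 by (simp add: ln_ge_iff)
  have F1: "card F \<ge> 1" using Fne Ffin by (simp add: Suc_le_eq card_gt_0_iff)
  have "ln (real (card F)) \<le> ln (real n * real n)"
    using F1 Fcard n3 by (simp flip: of_nat_mult)
  also have "\<dots> = 2 * ln (real n)" using n3 by (simp add: ln_mult)
  finally have lnF: "ln (real (card F)) \<le> 2 * ln (real n)" .
  obtain S where "S \<in> F" using Fne by blast
  hence "s \<le> card S" "card S \<le> n"
    using Fsets[of S] card_mono[OF finite_verts, of S] assms(3) by simp_all
  hence "s \<le> n" by (rule le_trans)
  hence ns: "1 \<le> real n / real s" using s0 by simp
  define M where "M = real n / real s * ln (real n)"
  have "1 * 1 \<le> M" unfolding M_def by (rule mult_mono[OF ns ln1]) simp_all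
  have "real n / real s * ln (real (card F)) \<le> real n / real s * (2 * ln (real n))"
    by (rule mult_left_mono[OF lnF]) simp
  also have "\<dots> = 2 * M" by (simp add: M_def)
  finally have "real (cop_number G) \<le> 6 * M" using cop \<open>1 * 1 \<le> M\<close> by linarith
  also have "6 * M = 6 * real n * ln (real n) / (real \<delta> - 1) ^ r"
    using assms(6) by (simp add: M_def s_def)
  finally show ?thesis by (simp add: r_def)
qed

end
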